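(* Let the underlying IMEX Runge–Kutta method be $p$-th order accurate with $p\ge 2$, and let $u^\varepsilon$ be the (sufficiently smooth) exact solution of the energy regularized logarithmic Schrödinger equation. Then the truncation error of the IMEX relaxation Runge–Kutta method $$ \begin{cases} u^\varepsilon_{i}=u^{\varepsilon,n}_{\gamma}+\tau\sum_{j=1}^{i}a^{I}_{ij}g^{I}_{j}+\tau\sum_{j=1}^{i-1}a^{E}_{ij}g^{E}_{j},\quad i=1,\ldots,s,\\[4pt] u^{\varepsilon,n+1}=u^{\varepsilon,n}_{\gamma}+\tau\sum_{j=1}^{s}b^{I}_{j}g^{I}_{j}+\tau\sum_{j=1}^{s}b^{E}_{j}g^{E}_{j},\\[4pt] u^{\varepsilon,n+1}_{\gamma}=u^{\varepsilon,n+1}+(\gamma_{n}-1)\big(u^{\varepsilon,n+1}-u^{\varepsilon,n}_{\gamma}\big) \end{cases} $$ is $O(\tau^{p+1})$; that is, with $\hat t_{n+1}=\hat t_n+\gamma_n\tau$ and $$\Phi_n(u^\varepsilon)=u^\varepsilon(\hat t_n)+\tau\sum_{j=1}^s b^I_j\,g^I\big(u^\varepsilon(\hat t_n+c_j\tau)\big)+\tau\sum_{j=1}^s b^E_j\,g^E\big(u^\varepsilon(\hat t_n+c_j\tau)\big),$$ one has $$\mathcal T^{n+1}:=u^\varepsilon(\hat t_{n+1})-\Phi_n(u^\varepsilon)-(\gamma_n-1)\big(\Phi_n(u^\varepsilon)-u^\varepsilon(\hat t_n)\big)=O(\tau^{p+1})\quad\text{as }\tau\to0.$$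
   Context: Let $\Omega\subset\mathbb R^d$ ($d\ge 1$) be a bounded domain with smooth boundary, $\lambda\in\mathbb R\setminus\{0\}$, $0<\varepsilon\ll 1$ fixed, and $k\ge 2$ an integer. $(\cdot,\cdot)$ and $\|\cdot\|$ denote the inner product and norm of the complex space $L^2(\Omega)$. The energy regularized logarithmic Schrödinger equation (ERLogSE) is $\mathrm{i}\,\partial_t u^\varepsilon+\Delta u^\varepsilon=\lambda u^\varepsilon f^\varepsilon_k(|u^\varepsilon|^2)$, with initial condition $u^\varepsilon(x,0)=u_0(x)$, where for $\rho\ge 0$ $$f_k^\varepsilon(\rho)=\begin{cases}\ln\rho, & \rho\ge\varepsilon^2,\\ \ln(\varepsilon^2)-\frac{k+1}{k}\big(1-\frac{\rho}{\varepsilon^2}\big)^k-\sum_{j=1}^{k-1}\frac1j\big(1-\frac{\rho}{\varepsilon^2}\big)^j, & \rho<\varepsilon^2.\end{cases}$$ It is written as $u^\varepsilon_t=g^I(u^\varepsilon)+g^E(u^\varepsilon)$ with $g^I(u)=\mathrm{i}\Delta u$ and $g^E(u)=-\mathrm{i}\lambda u f_k^\varepsilon(|u|^2)$. An $s$-stage implicit-explicit (IMEX) Runge–Kutta method is given by real coefficients $A^I=(a^I_{ij})_{s\times s}$ with $a^I_{ij}=0$ for $j>i$, $A^E=(a^E_{ij})_{s\times s}$ with $a^E_{ij}=0$ for $j\ge i$, weights $b^I,b^E\in\mathbb R^s$, and abscissae $c_i=\sum_j a^I_{ij}=\sum_j a^E_{ij}$. Here $g^I_j=g^I(u^\varepsilon_j)$,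 $g^E_j=g^E(u^\varepsilon_j)$. That the IMEX Runge–Kutta method is $p$-th order accurate is used in the sense that inserting the exact solution in its update formula leaves a residual of order $p+1$: $u^\varepsilon(\hat t_n+\tau)=\Phi_n(u^\varepsilon)+O(\tau^{p+1})$. The relaxation coefficient $\gamma_n$ is $1$ if $S:=\sum_j b^I_jg^I_j+\sum_j b^E_jg^E_j=0$, and otherwise $$\gamma_n=\frac{-2\operatorname{Re}(S,u^{\varepsilon,n}_\gamma)}{\tau\|S\|^2}.$$ It is a known fact, taken as given, that if the IMEX Runge–Kutta method is $p$-th order accurate with $p\ge2$, then for sufficiently small $\tau$ one has $\gamma_n=1+O(\tau^{p-1})$. *)

theory Defs
  imports "HOL-Analysis.Analysis" "HOL-Library.Landau_Symbols"
begin

section \<open>Smoothness, domains and the Laplacian\<close>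

text \<open>\<open>Ck_on m f S\<close> is meant for open \<open>S\<close>.\<close>

primrec Ck_on ::
  "nat \<Rightarrow> ('a::real_normed_vector \<Rightarrow> 'b::real_normed_vector) \<Rightarrow> 'a set \<Rightarrow> bool" where
  "Ck_on 0 = (\<lambda>f S. continuous_on S f)"
| "Ck_on (Suc m) = (\<lambda>f S. (\<forall>x\<in>S. f differentiable (at x)) \<and>
      (\<forall>v. Ck_on m (\<lambda>x. frechet_derivative f (at x) v) S))"

text \<open>On a set that is not open, being of class \<open>C\<^sup>m\<close> means having a \<open>C\<^sup>m\<close> extension to an
  open neighbourhood.\<close>

definition Ck_upto ::
  "nat \<Rightarrow> ('a::real_normed_vector \<Rightarrow> 'b::real_normed_vector) \<Rightarrow> 'a set \<Rightarrow> bool" where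
  "Ck_upto m f K \<longleftrightarrow> (\<exists>W g. open W \<and> K \<subseteq> W \<and> Ck_on m g W \<and> (\<forall>z\<in>K. g z = f z))"

text \<open>Near each boundary point, \<open>\<Omega>\<close> is a strict sublevel set of a \<open>C\<^sup>\<infinity>\<close> function without
  critical points.\<close>

definition smooth_boundary :: "'a::euclidean_space set \<Rightarrow> bool" where
  "smooth_boundary \<Omega> \<longleftrightarrow> (\<forall>z\<in>frontier \<Omega>. \<exists>U (\<phi> :: 'a \<Rightarrow> real).
      open U \<and> z \<in> U \<and> (\<forall>m. Ck_on m \<phi> U) \<and>
      (\<forall>x\<in>U. \<exists>v. frechet_derivative \<phi> (at x) v \<noteq> 0) \<and>
      \<Omega> \<inter> U = {x\<in>U. \<phi> x < 0} \<and> frontier \<Omega> \<inter> U = {x\<in>U. \<phi> x = 0})"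

definition smooth_bounded_domain :: "'a::euclidean_space set \<Rightarrow> bool" where
  "smooth_bounded_domain \<Omega> \<longleftrightarrow>
     open \<Omega> \<and> connected \<Omega> \<and> \<Omega> \<noteq> {} \<and> bounded \<Omega> \<and> smooth_boundary \<Omega>"

definition laplacian :: "('a::euclidean_space \<Rightarrow> complex) \<Rightarrow> 'a \<Rightarrow> complex" where
  "laplacian v x =
     (\<Sum>b\<in>Basis. frechet_derivative (\<lambda>y. frechet_derivative v (at y) b) (at x) b)"

section \<open>The complex space $L^2(\Omega)$\<close>

definition in_L2 :: "'a::euclidean_space set \<Rightarrow> ('a \<Rightarrow> complex) \<Rightarrow> bool" where
  "in_L2 \<Omega> f \<longleftrightarrow> set_borel_measurable lebesgue \<Omega> f \<and>
     set_integrable lebesgue \<Omega> (\<lambda>x. (cmod (f x))\<^sup>2)"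

definition L2_inner ::
  "'a::euclidean_space set \<Rightarrow> ('a \<Rightarrow> complex) \<Rightarrow> ('a \<Rightarrow> complex) \<Rightarrow> complex" where
  "L2_inner \<Omega> f g = (LINT x:\<Omega>|lebesgue. f x * cnj (g x))"

definition L2_norm :: "'a::euclidean_space set \<Rightarrow> ('a \<Rightarrow> complex) \<Rightarrow> real" where
  "L2_norm \<Omega> f = sqrt (LINT x:\<Omega>|lebesgue. (cmod (f x))\<^sup>2)"

text \<open>\<open>F(\<tau>) = O(\<tau>\<^sup>q)\<close> in \<open>L\<^sup>2(\<Omega>)\<close> as \<open>\<tau>\<close> tends to \<open>0\<close> from the right. Since the Bochner integral of a
  non-integrable function is \<open>0\<close>, membership in \<open>L\<^sup>2(\<Omega>)\<close> has to be demanded separately.\<close>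

definition L2_bigo ::
  "'a::euclidean_space set \<Rightarrow> (real \<Rightarrow> 'a \<Rightarrow> complex) \<Rightarrow> nat \<Rightarrow> bool" where
  "L2_bigo \<Omega> F q \<longleftrightarrow> (\<forall>\<^sub>F \<tau> in at_right 0. in_L2 \<Omega> (F \<tau>)) \<and>
     (\<lambda>\<tau>. L2_norm \<Omega> (F \<tau>)) \<in> O[at_right 0](\<lambda>\<tau>. \<tau> ^ q)"

section \<open>The energy regularized logarithmic Schroedinger equation\<close>

definition f_reg :: "real \<Rightarrow> nat \<Rightarrow> real \<Rightarrow> real" where
  "f_reg \<epsilon> k \<rho> =
     (if \<rho> \<ge> \<epsilon>\<^sup>2 then ln \<rho>
      else ln (\<epsilon>\<^sup>2) - (real k + 1) / real k * (1 - \<rho> / \<epsilon>\<^sup>2) ^ k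
             - (\<Sum>j=1..k-1. 1 / real j * (1 - \<rho> / \<epsilon>\<^sup>2) ^ j))"

definition gI :: "('a::euclidean_space \<Rightarrow> complex) \<Rightarrow> 'a \<Rightarrow> complex" where
  "gI v x = \<i> * laplacian v x"

definition gE :: "real \<Rightarrow> real \<Rightarrow> nat \<Rightarrow> ('a \<Rightarrow> complex) \<Rightarrow> 'a \<Rightarrow> complex" where
  "gE lam \<epsilon> k v x =
     - \<i> * complex_of_real lam * v x * complex_of_real (f_reg \<epsilon> k ((cmod (v x))\<^sup>2))"

definition erlogse_solution ::
  "'a::euclidean_space set \<Rightarrow> real \<Rightarrow> real \<Rightarrow> nat \<Rightarrow> real \<Rightarrow> ('a \<Rightarrow> complex) \<Rightarrow>
     (real \<Rightarrow> 'a \<Rightarrow> complex) \<Rightarrow> bool" where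
  "erlogse_solution \<Omega> lam \<epsilon> k T u0 u \<longleftrightarrow>
     (\<forall>x\<in>\<Omega>. u 0 x = u0 x) \<and>
     (\<forall>t\<in>{0..T}. \<forall>x\<in>\<Omega>.
        (\<lambda>s. u s x) differentiable (at t within {0..T}) \<and>
        \<i> * vector_derivative (\<lambda>s. u s x) (at t within {0..T}) + laplacian (u t) x =
          complex_of_real lam * u t x * complex_of_real (f_reg \<epsilon> k ((cmod (u t x))\<^sup>2)))"

section \<open>IMEX relaxation Runge-Kutta schemes\<close>

text \<open>Stages are numbered from \<open>1\<close> to \<open>nstages\<close>; coefficients outside this range are never used.\<close>

record imex_tableau =
  nstages :: nat
  aI :: "nat \<Rightarrow> nat \<Rightarrow> real"
  aE :: "nat \<Rightarrow> nat \<Rightarrow> real"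
  bI :: "nat \<Rightarrow> real"
  bE :: "nat \<Rightarrow> real"

definition abscissa :: "imex_tableau \<Rightarrow> nat \<Rightarrow> real" where
  "abscissa M i = (\<Sum>j=1..nstages M. aI M i j)"

definition imex_rk :: "imex_tableau \<Rightarrow> bool" where
  "imex_rk M \<longleftrightarrow> nstages M \<ge> 1 \<and>
     (\<forall>i\<in>{1..nstages M}. \<forall>j\<in>{1..nstages M}.
        (j > i \<longrightarrow> aI M i j = 0) \<and> (j \<ge> i \<longrightarrow> aE M i j = 0)) \<and>
     (\<forall>i\<in>{1..nstages M}. (\<Sum>j=1..nstages M. aI M i j) = (\<Sum>j=1..nstages M. aE M i j))"

text \<open>The sum of the weighted stage slopes, for a family \<open>v\<close> of stage values.\<close>

definition slope_sum ::
  "imex_tableau \<Rightarrow> real \<Rightarrow> real \<Rightarrow> nat \<Rightarrow> (nat \<Rightarrow> 'a::euclidean_space \<Rightarrow> complex) \<Rightarrow>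
     'a \<Rightarrow> complex" where
  "slope_sum M lam \<epsilon> k v x =
     (\<Sum>j=1..nstages M. complex_of_real (bI M j) * gI (v j) x) +
     (\<Sum>j=1..nstages M. complex_of_real (bE M j) * gE lam \<epsilon> k (v j) x)"

text \<open>The condition \<open>S = 0\<close> is the one of \<open>L\<^sup>2(\<Omega>)\<close>, that is, almost everywhere.\<close>

definition relax_coeff ::
  "'a::euclidean_space set \<Rightarrow> real \<Rightarrow> ('a \<Rightarrow> complex) \<Rightarrow> ('a \<Rightarrow> complex) \<Rightarrow> real" where
  "relax_coeff \<Omega> \<tau> S w =
     (if AE x in lebesgue. x \<in> \<Omega> \<longrightarrow> S x = 0 then 1
      else - 2 * Re (L2_inner \<Omega> S w) / (\<tau> * (L2_norm \<Omega> S)\<^sup>2))"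

definition stage_system ::
  "'a::euclidean_space set \<Rightarrow> imex_tableau \<Rightarrow> real \<Rightarrow> real \<Rightarrow> nat \<Rightarrow> real \<Rightarrow>
     ('a \<Rightarrow> complex) \<Rightarrow> (nat \<Rightarrow> 'a \<Rightarrow> complex) \<Rightarrow> bool" where
  "stage_system \<Omega> M lam \<epsilon> k \<tau> w v \<longleftrightarrow>
     (\<forall>i\<in>{1..nstages M}.
        Ck_on 2 (v i) \<Omega> \<and> in_L2 \<Omega> (v i) \<and> in_L2 \<Omega> (gI (v i)) \<and> in_L2 \<Omega> (gE lam \<epsilon> k (v i)) \<and>
        (\<forall>x\<in>\<Omega>. v i x = w x
           + complex_of_real \<tau> * (\<Sum>j=1..i. complex_of_real (aI M i j) * gI (v j) x)
           + complex_of_real \<tau> * (\<Sum>j=1..<i. complex_of_real (aE M i j) * gE lam \<epsilon> k (v j) x)))"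

text \<open>A run of the scheme with parameter \<open>\<tau>\<close> through the steps \<open>0, \<dots>, N\<close>. Here \<open>U m\<close> is the relaxed
  numerical solution at the time \<open>th m\<close>, \<open>V m i\<close> is its \<open>i\<close>-th stage value, and \<open>\<gamma> m\<close> is the
  relaxation coefficient of the step from \<open>U m\<close> to \<open>U (Suc m)\<close>.\<close>

definition imex_rrk_run ::
  "'a::euclidean_space set \<Rightarrow> imex_tableau \<Rightarrow> real \<Rightarrow> real \<Rightarrow> nat \<Rightarrow> ('a \<Rightarrow> complex) \<Rightarrow>
     real \<Rightarrow> nat \<Rightarrow> (nat \<Rightarrow> 'a \<Rightarrow> complex) \<Rightarrow> (nat \<Rightarrow> nat \<Rightarrow> 'a \<Rightarrow> complex) \<Rightarrow>
     (nat \<Rightarrow> real) \<Rightarrow> (nat \<Rightarrow> real) \<Rightarrow> bool" where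
  "imex_rrk_run \<Omega> M lam \<epsilon> k u0 \<tau> N U V \<gamma> th \<longleftrightarrow>
     th 0 = 0 \<and> (\<forall>x\<in>\<Omega>. U 0 x = u0 x) \<and>
     (\<forall>m\<le>N.
        in_L2 \<Omega> (U m) \<and>
        stage_system \<Omega> M lam \<epsilon> k \<tau> (U m) (V m) \<and>
        \<gamma> m = relax_coeff \<Omega> \<tau> (slope_sum M lam \<epsilon> k (V m)) (U m) \<and>
        th (Suc m) = th m + \<gamma> m * \<tau> \<and>
        (\<forall>x\<in>\<Omega>. let unew = U m x + complex_of_real \<tau> * slope_sum M lam \<epsilon> k (V m) x
                in U (Suc m) x = unew + complex_of_real (\<gamma> m - 1) * (unew - U m x)))"

text \<open>The exact solution inserted in the update formula at time \<open>t\<close>, and the resulting truncation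
  error of the relaxed scheme; \<open>t + \<gamma> * \<tau>\<close> is the next relaxed time.\<close>

definition exact_update ::
  "imex_tableau \<Rightarrow> real \<Rightarrow> real \<Rightarrow> nat \<Rightarrow> (real \<Rightarrow> 'a::euclidean_space \<Rightarrow> complex) \<Rightarrow>
     real \<Rightarrow> real \<Rightarrow> 'a \<Rightarrow> complex" where
  "exact_update M lam \<epsilon> k u \<tau> t x =
     u t x + complex_of_real \<tau> * slope_sum M lam \<epsilon> k (\<lambda>j. u (t + abscissa M j * \<tau>)) x"

definition truncation_error ::
  "imex_tableau \<Rightarrow> real \<Rightarrow> real \<Rightarrow> nat \<Rightarrow> (real \<Rightarrow> 'a::euclidean_space \<Rightarrow> complex) \<Rightarrow>
     real \<Rightarrow> real \<Rightarrow> real \<Rightarrow> 'a \<Rightarrow> complex" where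
  "truncation_error M lam \<epsilon> k u \<tau> \<gamma> t x =
     u (t + \<gamma> * \<tau>) x - exact_update M lam \<epsilon> k u \<tau> t x
       - complex_of_real (\<gamma> - 1) * (exact_update M lam \<epsilon> k u \<tau> t x - u t x)"

end

theory Submission
  imports Defs
begin

text \<open>
  Write \<open>t\<close> for the current relaxed time, \<open>\<gamma>\<close> for the relaxation coefficient and
  \<open>R = u (t + \<tau>) - \<Phi>\<close> for the residual of the underlying method, which is \<open>O(\<tau>\<^sup>p\<^sup>+\<^sup>1)\<close> in
  \<open>L\<^sup>2(\<Omega>)\<close> by the order assumption. Replacing \<open>\<Phi>\<close> by \<open>u (t + \<tau>) - R\<close> splits the truncation error
  (\<open>truncation_error_split\<close>) into
  \[ \bigl(u(t + \gamma\tau) - u(t + \tau) - (\gamma - 1)(u(t + \tau) - u(t))\bigr) + \gamma R . \]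

  Since \<open>\<gamma> = 1 + O(\<tau>\<^sup>p\<^sup>-\<^sup>1)\<close> is bounded, the second term is \<open>O(\<tau>\<^sup>p\<^sup>+\<^sup>1)\<close>. The first term no
  longer involves the scheme: it measures by how much the linear extrapolation of \<open>u\<close> from the
  times \<open>t\<close> and \<open>t + \<tau>\<close> misses \<open>u\<close> at the relaxed time \<open>t + \<gamma>\<tau>\<close>. As it vanishes for functions
  affine in time and for \<open>\<gamma> = 1\<close>, one expects, and Taylor expansion about \<open>t + \<tau>\<close> confirms for
  bounded \<open>\<gamma>\<close>, a bound by a multiple of \<open>\<bar>\<gamma> - 1\<bar>\<tau>\<^sup>2\<close> (\<open>three_point_defect_bound\<close>), which is again \<open>O(\<tau>\<^sup>p\<^sup>+\<^sup>1)\<close>.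

  The constant in this pointwise estimate is uniform in \<open>t\<close> and \<open>x\<close> because \<open>\<partial>\<^sub>t\<^sup>2u\<close> is bounded on the
  compact set \<open>[0,T] \<times> closure \<Omega>\<close> (\<open>Ck_upto_2_time_slices\<close>); as \<open>\<Omega>\<close> has finite measure, it turns
  into an estimate in \<open>L\<^sup>2(\<Omega>)\<close> (\<open>L2_bigo_uniform\<close>). The times at which \<open>u\<close> is evaluated may vary
  with \<open>\<tau>\<close>, which is why the uniformity in \<open>t\<close> matters.
\<close>

section \<open>Asymptotic estimates in $L^2(\Omega)$\<close>

lemma measurable_indicator_cmod_square:
  assumes "(\<lambda>x. indicator \<Omega> x *\<^sub>R (f x :: complex)) \<in> borel_measurable N"
  shows "(\<lambda>x. indicator \<Omega> x *\<^sub>R (cmod (f x))\<^sup>2) \<in> borel_measurable N"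
proof -
  have eq: "(\<lambda>x. indicator \<Omega> x *\<^sub>R (cmod (f x))\<^sup>2) = (\<lambda>x. (cmod (indicator \<Omega> x *\<^sub>R f x))\<^sup>2)"
    by (auto simp: indicator_def)
  show ?thesis
    unfolding eq
    by (rule borel_measurable_power[OF measurable_compose[OF assms borel_measurable_norm]])
qed

text \<open>The norm estimate has the factor \<open>2\<close> because it comes from the pointwise inequality
  \<open>\<bar>a + b\<bar>\<^sup>2 \<le> 2\<bar>a\<bar>\<^sup>2 + 2\<bar>b\<bar>\<^sup>2\<close>, which yields integrability at the same time; for orders of magnitude
  this is as good as Minkowski's inequality.\<close>

lemma in_L2_lincomb:
  assumes f: "in_L2 \<Omega> f" and g: "in_L2 \<Omega> g"
  shows "in_L2 \<Omega> (\<lambda>x. f x + c * g x)"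
    and "L2_norm \<Omega> (\<lambda>x. f x + c * g x) \<le> 2 * (L2_norm \<Omega> f + cmod c * L2_norm \<Omega> g)"
proof -
  have bound: "(cmod (f x + c * g x))\<^sup>2 \<le> 2 * (cmod (f x))\<^sup>2 + 2 * (cmod c)\<^sup>2 * (cmod (g x))\<^sup>2" for x
  proof -
    have "(cmod (f x + c * g x))\<^sup>2 \<le> (cmod (f x) + cmod c * cmod (g x))\<^sup>2"
      by (metis norm_ge_zero norm_mult norm_triangle_ineq power_mono)
    also have "\<dots> \<le> 2 * (cmod (f x))\<^sup>2 + 2 * (cmod c * cmod (g x))\<^sup>2"
      using sum_squares_bound[of "cmod (f x)" "cmod c * cmod (g x)"] by (simp add: power2_sum)
    finally show ?thesis by (simp add: power_mult_distrib)
  qed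
  have mf: "(\<lambda>x. indicator \<Omega> x *\<^sub>R f x) \<in> borel_measurable lebesgue"
    and mg: "(\<lambda>x. indicator \<Omega> x *\<^sub>R g x) \<in> borel_measurable lebesgue"
    using f g by (auto simp: in_L2_def set_borel_measurable_def)
  have "(\<lambda>x. indicator \<Omega> x *\<^sub>R (f x + c * g x)) =
      (\<lambda>x. indicator \<Omega> x *\<^sub>R f x + c * (indicator \<Omega> x *\<^sub>R g x))"
    by (auto simp: indicator_def)
  then have ms: "(\<lambda>x. indicator \<Omega> x *\<^sub>R (f x + c * g x)) \<in> borel_measurable lebesgue"
    by (simp only:) (intro borel_measurable_add borel_measurable_times borel_measurable_const mf mg)
  note mn = measurable_indicator_cmod_square[OF ms]
  have int_f: "set_integrable lebesgue \<Omega> (\<lambda>x. (cmod (f x))\<^sup>2)"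
    and int_g: "set_integrable lebesgue \<Omega> (\<lambda>x. (cmod (g x))\<^sup>2)"
    using f g by (auto simp: in_L2_def)
  have int_b: "set_integrable lebesgue \<Omega> (\<lambda>x. 2 * (cmod (f x))\<^sup>2 + 2 * (cmod c)\<^sup>2 * (cmod (g x))\<^sup>2)"
    using int_f int_g by (intro set_integral_add(1) set_integrable_mult_right) auto
  have int_s: "set_integrable lebesgue \<Omega> (\<lambda>x. (cmod (f x + c * g x))\<^sup>2)"
    unfolding set_integrable_def
    by (rule Bochner_Integration.integrable_bound[OF int_b[unfolded set_integrable_def] mn])
       (auto simp: indicator_def intro!: AE_I2 order_trans[OF bound])
  show "in_L2 \<Omega> (\<lambda>x. f x + c * g x)"
    using ms int_s by (simp add: in_L2_def set_borel_measurable_def)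
  let ?A = "LINT x:\<Omega>|lebesgue. (cmod (f x))\<^sup>2" and ?B = "LINT x:\<Omega>|lebesgue. (cmod (g x))\<^sup>2"
  have nonneg: "?A \<ge> 0" "?B \<ge> 0"
    by (auto simp: set_lebesgue_integral_def intro!: Bochner_Integration.integral_nonneg)
  have "(LINT x:\<Omega>|lebesgue. (cmod (f x + c * g x))\<^sup>2) \<le>
      (LINT x:\<Omega>|lebesgue. 2 * (cmod (f x))\<^sup>2 + 2 * (cmod c)\<^sup>2 * (cmod (g x))\<^sup>2)"
    by (rule set_integral_mono[OF int_s int_b]) (rule bound)
  also have "\<dots> = 2 * ?A + 2 * (cmod c)\<^sup>2 * ?B"
    using int_f int_g by (subst set_integral_add(2)) auto
  also have "\<dots> \<le> (2 * (sqrt ?A + cmod c * sqrt ?B))\<^sup>2"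
    using nonneg by (simp add: power2_sum power_mult_distrib algebra_simps)
  finally show "L2_norm \<Omega> (\<lambda>x. f x + c * g x) \<le> 2 * (L2_norm \<Omega> f + cmod c * L2_norm \<Omega> g)"
    using nonneg unfolding L2_norm_def by (intro real_le_lsqrt) auto
qed

lemma L2_norm_nonneg: "L2_norm \<Omega> f \<ge> 0"
  by (auto simp: L2_norm_def set_lebesgue_integral_def intro!: Bochner_Integration.integral_nonneg)

lemma in_L2_bounded_continuous:
  assumes \<Omega>: "open \<Omega>" "bounded \<Omega>" and cont: "continuous_on \<Omega> f"
    and bound: "\<And>x. x \<in> \<Omega> \<Longrightarrow> cmod (f x) \<le> C" and "C \<ge> 0"
  shows "in_L2 \<Omega> f" and "L2_norm \<Omega> f \<le> C * sqrt (measure lebesgue \<Omega>)"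
proof -
  have fin: "\<Omega> \<in> lmeasurable"
    using \<Omega> by (intro bounded_set_imp_lmeasurable) auto
  have ms: "(\<lambda>x. indicator \<Omega> x *\<^sub>R f x) \<in> borel_measurable lebesgue"
    using borel_measurable_continuous_on_indicator[OF _ cont] \<Omega>
    by (intro measurable_completion) auto
  note mn = measurable_indicator_cmod_square[OF ms]
  have int_C: "set_integrable lebesgue \<Omega> (\<lambda>x. C\<^sup>2)"
    unfolding set_integrable_def using fin
    by (intro integrable_scaleR_left integrable_real_indicator) (auto simp: fmeasurable_def)
  have bound2: "(cmod (f x))\<^sup>2 \<le> C\<^sup>2" if "x \<in> \<Omega>" for x
    using bound[OF that] by (simp add: power_mono)
  have int_f: "set_integrable lebesgue \<Omega> (\<lambda>x. (cmod (f x))\<^sup>2)"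
    unfolding set_integrable_def
    by (rule Bochner_Integration.integrable_bound[OF int_C[unfolded set_integrable_def] mn])
       (auto simp: indicator_def bound2 intro!: AE_I2)
  show "in_L2 \<Omega> f"
    using ms int_f by (simp add: in_L2_def set_borel_measurable_def)
  have "(LINT x:\<Omega>|lebesgue. (cmod (f x))\<^sup>2) \<le> (LINT x:\<Omega>|lebesgue. C\<^sup>2)"
    by (rule set_integral_mono[OF int_f int_C]) (rule bound2)
  also have "\<dots> = C\<^sup>2 * measure lebesgue \<Omega>"
    unfolding set_lebesgue_integral_def using fin by simp
  also have "\<dots> = (C * sqrt (measure lebesgue \<Omega>))\<^sup>2"
    by (simp add: power_mult_distrib)
  finally show "L2_norm \<Omega> f \<le> C * sqrt (measure lebesgue \<Omega>)"
    unfolding L2_norm_def using \<open>C \<ge> 0\<close> by (intro real_le_lsqrt) auto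
qed

lemma L2_bigo_lincomb:
  assumes F: "L2_bigo \<Omega> F q" and G: "L2_bigo \<Omega> G q"
    and c: "(\<lambda>\<tau>. cmod (c \<tau>)) \<in> O[at_right 0](\<lambda>_. 1)"
  shows "L2_bigo \<Omega> (\<lambda>\<tau> x. F \<tau> x + c \<tau> * G \<tau> x) q"
proof -
  have "\<forall>\<^sub>F \<tau> in at_right 0. norm (L2_norm \<Omega> (\<lambda>x. F \<tau> x + c \<tau> * G \<tau> x)) \<le>
      2 * norm (L2_norm \<Omega> (F \<tau>) + cmod (c \<tau>) * L2_norm \<Omega> (G \<tau>))"
    using conjunct1[OF F[unfolded L2_bigo_def]] conjunct1[OF G[unfolded L2_bigo_def]]
    by eventually_elim (use in_L2_lincomb(2) in \<open>simp add: L2_norm_nonneg\<close>)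
  then have "(\<lambda>\<tau>. L2_norm \<Omega> (\<lambda>x. F \<tau> x + c \<tau> * G \<tau> x)) \<in>
      O[at_right 0](\<lambda>\<tau>. L2_norm \<Omega> (F \<tau>) + cmod (c \<tau>) * L2_norm \<Omega> (G \<tau>))"
    by (rule bigoI)
  also have "(\<lambda>\<tau>. L2_norm \<Omega> (F \<tau>) + cmod (c \<tau>) * L2_norm \<Omega> (G \<tau>)) \<in> O[at_right 0](\<lambda>\<tau>. \<tau> ^ q)"
    using F landau_o.big.mult[OF c, of "\<lambda>\<tau>. L2_norm \<Omega> (G \<tau>)" "\<lambda>\<tau>. \<tau> ^ q"] G
    by (intro sum_in_bigo) (auto simp: L2_bigo_def)
  finally have "(\<lambda>\<tau>. L2_norm \<Omega> (\<lambda>x. F \<tau> x + c \<tau> * G \<tau> x)) \<in> O[at_right 0](\<lambda>\<tau>. \<tau> ^ q)" .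
  moreover have "\<forall>\<^sub>F \<tau> in at_right 0. in_L2 \<Omega> (\<lambda>x. F \<tau> x + c \<tau> * G \<tau> x)"
    using conjunct1[OF F[unfolded L2_bigo_def]] conjunct1[OF G[unfolded L2_bigo_def]]
    by eventually_elim (rule in_L2_lincomb(1))
  ultimately show ?thesis by (simp add: L2_bigo_def)
qed

lemma L2_bigo_uniform:
  assumes \<Omega>: "open \<Omega>" "bounded \<Omega>"
    and cont: "\<forall>\<^sub>F \<tau> in at_right 0. continuous_on \<Omega> (F \<tau>)"
    and bound: "\<forall>\<^sub>F \<tau> in at_right 0. \<forall>x\<in>\<Omega>. cmod (F \<tau> x) \<le> C * \<tau> ^ q" and C: "C \<ge> 0"
  shows "L2_bigo \<Omega> F q"
proof -
  have pos: "\<forall>\<^sub>F \<tau>::real in at_right 0. \<tau> > 0"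
    by (rule eventually_at_right_less)
  have "\<forall>\<^sub>F \<tau> in at_right 0. in_L2 \<Omega> (F \<tau>)"
    using cont bound pos
  proof eventually_elim
    case (elim \<tau>)
    then show ?case
      using C by (intro in_L2_bounded_continuous(1)[OF \<Omega>, of _ "C * \<tau> ^ q"]) auto
  qed
  moreover have "\<forall>\<^sub>F \<tau> in at_right 0.
      norm (L2_norm \<Omega> (F \<tau>)) \<le> (C * sqrt (measure lebesgue \<Omega>)) * norm (\<tau> ^ q)"
    using cont bound pos
  proof eventually_elim
    case (elim \<tau>)
    then have "L2_norm \<Omega> (F \<tau>) \<le> C * \<tau> ^ q * sqrt (measure lebesgue \<Omega>)"
      by (intro in_L2_bounded_continuous(2)[OF \<Omega>]) (use C in auto)
    then show ?case
      using elim by (simp add: L2_norm_nonneg mult_ac)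
  qed
  ultimately show ?thesis
    by (auto simp: L2_bigo_def intro: bigoI)
qed

section \<open>The extrapolation defect of a function that is smooth in time\<close>

text \<open>This turns joint smoothness in \<open>(t, x)\<close> into the data needed to expand in time at fixed \<open>x\<close>.
  The \<open>C\<^sup>2\<close> extension to an open set has directional derivatives along \<open>(1, 0)\<close>; the second one is
  continuous, hence bounded on the compact set \<open>[a,b] \<times> K\<close>, and this bound is a Lipschitz constant
  for the time derivative \<open>D\<close> that works for every \<open>x\<close>.\<close>

lemma Ck_upto_2_time_slices:
  fixes u :: "real \<Rightarrow> 'a::real_normed_vector \<Rightarrow> 'b::real_normed_vector"
  assumes smooth: "Ck_upto 2 (\<lambda>(t, x). u t x) ({a..b} \<times> K)" and K: "compact K"
  obtains D B where "B \<ge> 0"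
    and "\<And>t x. \<lbrakk>t \<in> {a..b}; x \<in> K\<rbrakk> \<Longrightarrow> ((\<lambda>s. u s x) has_vector_derivative D t x) (at t within {a..b})"
    and "\<And>s t x. \<lbrakk>s \<in> {a..b}; t \<in> {a..b}; x \<in> K\<rbrakk> \<Longrightarrow> norm (D s x - D t x) \<le> B * \<bar>s - t\<bar>"
    and "\<And>t. t \<in> {a..b} \<Longrightarrow> continuous_on K (u t)"
proof -
  obtain W g where W: "open W" "{a..b} \<times> K \<subseteq> W" and g: "Ck_on 2 g W"
    and eq: "\<And>t x. \<lbrakk>t \<in> {a..b}; x \<in> K\<rbrakk> \<Longrightarrow> g (t, x) = u t x"
    using smooth unfolding Ck_upto_def by fastforce
  define Dg where "Dg = (\<lambda>z. frechet_derivative g (at z) (1, 0))"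
  define DDg where "DDg = (\<lambda>z. frechet_derivative Dg (at z) (1, 0))"
  have diff_g: "\<And>z. z \<in> W \<Longrightarrow> g differentiable (at z)"
    and diff_Dg: "\<And>z. z \<in> W \<Longrightarrow> Dg differentiable (at z)"
    and cont_DDg: "continuous_on W DDg"
    using g by (auto simp: numeral_2_eq_2 Dg_def DDg_def)
  have slice: "((\<lambda>s. h (s, x)) has_vector_derivative frechet_derivative h (at (t, x)) (1, 0))
      (at t within {a..b})"
    if "t \<in> {a..b}" "x \<in> K" and h: "\<And>z. z \<in> W \<Longrightarrow> h differentiable (at z)"
    for h :: "real \<times> 'a \<Rightarrow> 'b" and t x
  proof -
    have "(t, x) \<in> W" using that(1,2) W(2) by blast
    then have hd: "(h has_derivative frechet_derivative h (at (t, x))) (at (t, x))"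
      using h frechet_derivative_works by metis
    have "((\<lambda>s. (s, x)) has_derivative (\<lambda>s. (s, 0))) (at t within {a..b})"
      by (auto intro!: derivative_eq_intros)
    from has_derivative_compose[OF this hd]
    have "((\<lambda>s. h (s, x)) has_derivative (\<lambda>s. frechet_derivative h (at (t, x)) (s, 0)))
        (at t within {a..b})" .
    moreover have "frechet_derivative h (at (t, x)) (s, 0) =
        s *\<^sub>R frechet_derivative h (at (t, x)) (1, 0)" for s
    proof -
      have "(s, 0) = s *\<^sub>R (1, 0 :: 'a)" for s :: real by simp
      then show ?thesis
        by (metis linear_cmul[OF has_derivative_linear[OF hd]])
    qed
    then have "frechet_derivative h (at (t, x)) \<circ> (\<lambda>s. (s, 0)) =
        (\<lambda>s. s *\<^sub>R frechet_derivative h (at (t, x)) (1, 0))"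
      unfolding comp_def by (rule ext)
    ultimately show ?thesis
      unfolding has_vector_derivative_def comp_def by (rule back_subst[where P = "\<lambda>F. (_ has_derivative F) _"])
  qed
  have "compact (DDg ` ({a..b} \<times> K))"
    using W(2) K by (intro compact_continuous_image continuous_on_subset[OF cont_DDg] compact_Times) auto
  then obtain B where B: "\<And>z. z \<in> {a..b} \<times> K \<Longrightarrow> norm (DDg z) \<le> B"
    by (force dest: compact_imp_bounded simp: bounded_iff)
  \<comment> \<open>If \<open>{a..b} \<times> K\<close> is empty, \<open>B\<close> may be negative.\<close>
  show ?thesis
  proof (rule that[of "max B 0" "\<lambda>t x. Dg (t, x)"])
    show "max B 0 \<ge> 0" by simp
  next
    fix t x assume tx: "t \<in> {a..b}" "x \<in> K"
    have "((\<lambda>s. g (s, x)) has_vector_derivative Dg (t, x)) (at t within {a..b})"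
      unfolding Dg_def by (rule slice[OF tx diff_g])
    then show "((\<lambda>s. u s x) has_vector_derivative Dg (t, x)) (at t within {a..b})"
      by (rule has_vector_derivative_transform[OF tx(1), rotated]) (use tx eq in auto)
  next
    fix s t x assume stx: "s \<in> {a..b}" "t \<in> {a..b}" "x \<in> K"
    have "norm (Dg (s, x) - Dg (t, x)) \<le> max B 0 * norm (s - t)"
    proof (rule differentiable_bound[of "{a..b}" "\<lambda>s. Dg (s, x)" "\<lambda>s h. h *\<^sub>R DDg (s, x)"])
      fix r assume r: "r \<in> {a..b}"
      show "((\<lambda>s. Dg (s, x)) has_derivative (\<lambda>h. h *\<^sub>R DDg (r, x))) (at r within {a..b})"
        using slice[OF r stx(3) diff_Dg] by (simp add: DDg_def has_vector_derivative_def)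
      show "onorm (\<lambda>h. h *\<^sub>R DDg (r, x)) \<le> max B 0"
        using B[of "(r, x)"] r stx(3)
        by (intro onorm_bound) (auto simp: mult.commute intro!: mult_left_mono)
    qed (use stx in auto)
    then show "norm (Dg (s, x) - Dg (t, x)) \<le> max B 0 * \<bar>s - t\<bar>" by simp
  next
    fix t assume t: "t \<in> {a..b}"
    have "continuous_on W g"
      using diff_g by (simp add: continuous_at_imp_continuous_on differentiable_imp_continuous_within)
    moreover have "continuous_on K (Pair t)"
      by (intro continuous_on_Pair continuous_on_const continuous_on_id)
    moreover have "Pair t ` K \<subseteq> W"
      using W(2) t by blast
    ultimately have "continuous_on K (\<lambda>x. g (t, x))"
      by (rule continuous_on_compose2)
    then show "continuous_on K (u t)"
      by (rule continuous_on_eq) (use t eq in auto)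
  qed
qed

text \<open>Expand \<open>f\<close> about the middle time \<open>t + \<tau>\<close> both forwards to \<open>t + \<gamma>\<tau>\<close> and backwards to \<open>t\<close>. The
  first order terms \<open>(\<gamma> - 1)\<tau> D (t + \<tau>)\<close> cancel, and the remainders \<open>B ((\<gamma> - 1)\<tau>)\<^sup>2\<close> and
  \<open>\<bar>\<gamma> - 1\<bar> B \<tau>\<^sup>2\<close> both retain a factor \<open>\<gamma> - 1\<close>.\<close>

lemma three_point_defect_bound:
  fixes f :: "real \<Rightarrow> 'b::real_normed_vector"
  assumes deriv: "\<And>t. t \<in> {a..b} \<Longrightarrow> (f has_vector_derivative D t) (at t within {a..b})"
    and Lip: "\<And>s t. \<lbrakk>s \<in> {a..b}; t \<in> {a..b}\<rbrakk> \<Longrightarrow> norm (D s - D t) \<le> B * \<bar>s - t\<bar>"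
    and B: "B \<ge> 0" and \<tau>: "\<tau> > 0"
    and times: "t \<in> {a..b}" "t + \<tau> \<in> {a..b}" "t + \<gamma> * \<tau> \<in> {a..b}"
  shows "norm (f (t + \<gamma> * \<tau>) - f (t + \<tau>) - (\<gamma> - 1) *\<^sub>R (f (t + \<tau>) - f t))
    \<le> B * \<bar>\<gamma> - 1\<bar> * (\<bar>\<gamma> - 1\<bar> + 1) * \<tau>\<^sup>2"
proof -
  have taylor: "norm (f y - f x - (y - x) *\<^sub>R D x) \<le> B * (y - x)\<^sup>2"
    if xy: "x \<in> {a..b}" "y \<in> {a..b}" for x y
  proof -
    have sub: "closed_segment x y \<subseteq> {a..b}"
      using xy by (intro closed_segment_subset) auto
    have "norm (f y - f x - (y - x) *\<^sub>R D x) \<le> norm (y - x) * (B * \<bar>y - x\<bar>)"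
    proof (rule vector_differentiable_bound_linearization[of "closed_segment x y"])
      fix z assume z: "z \<in> closed_segment x y"
      show "(f has_vector_derivative D z) (at z within closed_segment x y)"
        by (rule has_vector_derivative_within_subset[OF deriv sub]) (use z sub in blast)
      have "\<bar>z - x\<bar> \<le> \<bar>y - x\<bar>"
        using z by (auto simp: closed_segment_eq_real_ivl split: if_splits)
      then have "B * \<bar>z - x\<bar> \<le> B * \<bar>y - x\<bar>"
        using B by (rule mult_left_mono)
      with Lip[of z x] show "norm (D z - D x) \<le> B * \<bar>y - x\<bar>"
        using z sub xy by force
    qed auto
    then show ?thesis by (simp add: power2_eq_square mult_ac flip: abs_mult)
  qed
  let ?s = "t + \<tau>"
  let ?fwd = "f (t + \<gamma> * \<tau>) - f ?s - (t + \<gamma> * \<tau> - ?s) *\<^sub>R D ?s"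
  let ?bwd = "f t - f ?s - (t - ?s) *\<^sub>R D ?s"
  have "norm (f (t + \<gamma> * \<tau>) - f ?s - (\<gamma> - 1) *\<^sub>R (f ?s - f t)) = norm (?fwd + (\<gamma> - 1) *\<^sub>R ?bwd)"
    by (simp add: algebra_simps)
  also have "\<dots> \<le> norm ?fwd + \<bar>\<gamma> - 1\<bar> * norm ?bwd"
    by (metis norm_scaleR norm_triangle_ineq)
  also have "\<dots> \<le> B * (t + \<gamma> * \<tau> - ?s)\<^sup>2 + \<bar>\<gamma> - 1\<bar> * (B * (t - ?s)\<^sup>2)"
    by (intro add_mono mult_left_mono taylor times) auto
  also have "(t + \<gamma> * \<tau> - ?s)\<^sup>2 = (\<bar>\<gamma> - 1\<bar> * \<tau>)\<^sup>2"
    by (simp add: power_mult_distrib power2_eq_square algebra_simps)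
  finally show ?thesis
    by (simp add: power_mult_distrib power2_eq_square algebra_simps)
qed

section \<open>The truncation error of the relaxed scheme\<close>

lemma truncation_error_split:
  "truncation_error M lam \<epsilon> k u \<tau> \<gamma> t = (\<lambda>x.
     (u (t + \<gamma> * \<tau>) x - u (t + \<tau>) x - (\<gamma> - 1) *\<^sub>R (u (t + \<tau>) x - u t x)) +
     complex_of_real \<gamma> * (u (t + \<tau>) x - exact_update M lam \<epsilon> k u \<tau> t x))"
  by (rule ext) (simp add: truncation_error_def scaleR_conv_of_real algebra_simps)

theorem theorem3p2:
  fixes \<Omega> :: "'a::euclidean_space set"
    and lam \<epsilon> T :: real and k p :: nat
    and M :: imex_tableau
    and u0 :: "'a \<Rightarrow> complex" and u :: "real \<Rightarrow> 'a \<Rightarrow> complex"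
    and n :: "real \<Rightarrow> nat" \<comment> \<open>the step number may vary with \<open>\<tau>\<close>; constant \<open>n\<close> is a special case\<close>
    and U :: "real \<Rightarrow> nat \<Rightarrow> 'a \<Rightarrow> complex"
    and V :: "real \<Rightarrow> nat \<Rightarrow> nat \<Rightarrow> 'a \<Rightarrow> complex"
    and \<gamma> th :: "real \<Rightarrow> nat \<Rightarrow> real"
  assumes domain: "smooth_bounded_domain \<Omega>"
    and params: "lam \<noteq> 0" "0 < \<epsilon>" "\<epsilon> < 1" "k \<ge> 2" "T > 0" "p \<ge> 2"
    and solution: "erlogse_solution \<Omega> lam \<epsilon> k T u0 u"
    and smooth: "Ck_upto 2 (\<lambda>(t, x). u t x) ({0..T} \<times> closure \<Omega>)"
    and tableau: "imex_rk M"
    and run: "\<forall>\<^sub>F \<tau> in at_right 0.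
      imex_rrk_run \<Omega> M lam \<epsilon> k u0 \<tau> (n \<tau>) (U \<tau>) (V \<tau>) (\<gamma> \<tau>) (th \<tau>)"
    and times: "\<forall>\<^sub>F \<tau> in at_right 0.
      {th \<tau> (n \<tau>), th \<tau> (n \<tau>) + \<tau>, th \<tau> (Suc (n \<tau>))} \<subseteq> {0..T}"
    and order_p: "L2_bigo \<Omega>
      (\<lambda>\<tau> x. u (th \<tau> (n \<tau>) + \<tau>) x - exact_update M lam \<epsilon> k u \<tau> (th \<tau> (n \<tau>)) x) (p + 1)"
    and relaxation: "(\<lambda>\<tau>. \<gamma> \<tau> (n \<tau>) - 1) \<in> O[at_right 0](\<lambda>\<tau>. \<tau> ^ (p - 1))"
  shows "L2_bigo \<Omega>
    (\<lambda>\<tau>. truncation_error M lam \<epsilon> k u \<tau> (\<gamma> \<tau> (n \<tau>)) (th \<tau> (n \<tau>))) (p + 1)"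
proof -
  let ?t = "\<lambda>\<tau>. th \<tau> (n \<tau>)" and ?g = "\<lambda>\<tau>. \<gamma> \<tau> (n \<tau>)"
  let ?defect = "\<lambda>\<tau> x. u (?t \<tau> + ?g \<tau> * \<tau>) x - u (?t \<tau> + \<tau>) x
    - (?g \<tau> - 1) *\<^sub>R (u (?t \<tau> + \<tau>) x - u (?t \<tau>) x)"
  have \<Omega>: "open \<Omega>" "bounded \<Omega>"
    using domain by (auto simp: smooth_bounded_domain_def)
  obtain D B where B: "B \<ge> 0"
    and deriv: "\<And>t x. \<lbrakk>t \<in> {0..T}; x \<in> closure \<Omega>\<rbrakk> \<Longrightarrow>
      ((\<lambda>s. u s x) has_vector_derivative D t x) (at t within {0..T})"
    and Lip: "\<And>s t x. \<lbrakk>s \<in> {0..T}; t \<in> {0..T}; x \<in> closure \<Omega>\<rbrakk> \<Longrightarrow>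
      norm (D s x - D t x) \<le> B * \<bar>s - t\<bar>"
    and cont: "\<And>t. t \<in> {0..T} \<Longrightarrow> continuous_on (closure \<Omega>) (u t)"
    using Ck_upto_2_time_slices[OF smooth] \<Omega>(2) compact_closure by metis
  obtain c where c: "c > 0"
    and \<gamma>_bound: "\<forall>\<^sub>F \<tau> in at_right 0. norm (?g \<tau> - 1) \<le> c * norm (\<tau> ^ (p - 1))"
    using relaxation by (elim landau_o.bigE) auto
  have small: "\<forall>\<^sub>F \<tau>::real in at_right 0. 0 < \<tau> \<and> \<tau> < 1"
    using eventually_at_right_real[of 0 1] by simp
  have in_range: "\<forall>\<^sub>F \<tau> in at_right 0.
      ?t \<tau> \<in> {0..T} \<and> ?t \<tau> + \<tau> \<in> {0..T} \<and> ?t \<tau> + ?g \<tau> * \<tau> \<in> {0..T}"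
    using run times
  proof eventually_elim
    case (elim \<tau>)
    then have "th \<tau> (Suc (n \<tau>)) = ?t \<tau> + ?g \<tau> * \<tau>"
      unfolding imex_rrk_run_def by blast
    with elim(2) show ?case by simp
  qed
  \<comment> \<open>The rate makes the defect small; the crude bound controls its factor \<open>\<bar>\<gamma> - 1\<bar> + 1\<close> and the
    factor \<open>\<gamma>\<close> of the residual.\<close>
  have near_one: "\<forall>\<^sub>F \<tau> in at_right 0. \<bar>?g \<tau> - 1\<bar> \<le> c * \<tau> ^ (p - 1) \<and> \<bar>?g \<tau> - 1\<bar> \<le> c"
    using \<gamma>_bound small
  proof eventually_elim
    case (elim \<tau>)
    moreover have "c * \<tau> ^ (p - 1) \<le> c * 1"
      using elim c by (intro mult_left_mono power_le_one) auto
    ultimately show ?case by simp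
  qed
  have "L2_bigo \<Omega> ?defect (p + 1)"
  proof (rule L2_bigo_uniform[OF \<Omega>])
    show "\<forall>\<^sub>F \<tau> in at_right 0. continuous_on \<Omega> (?defect \<tau>)"
      using in_range
      by eventually_elim
        (auto intro!: continuous_intros continuous_on_subset[OF cont closure_subset])
    show "\<forall>\<^sub>F \<tau> in at_right 0. \<forall>x\<in>\<Omega>. cmod (?defect \<tau> x) \<le> (B * c * (c + 1)) * \<tau> ^ (p + 1)"
      using in_range near_one small
    proof (eventually_elim, intro ballI)
      fix \<tau> x
      assume t: "?t \<tau> \<in> {0..T} \<and> ?t \<tau> + \<tau> \<in> {0..T} \<and> ?t \<tau> + ?g \<tau> * \<tau> \<in> {0..T}"
        and g: "\<bar>?g \<tau> - 1\<bar> \<le> c * \<tau> ^ (p - 1) \<and> \<bar>?g \<tau> - 1\<bar> \<le> c"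
        and \<tau>: "0 < \<tau> \<and> \<tau> < 1" and "x \<in> \<Omega>"
      then have x: "x \<in> closure \<Omega>" using closure_subset by blast
      have "cmod (?defect \<tau> x) \<le> B * \<bar>?g \<tau> - 1\<bar> * (\<bar>?g \<tau> - 1\<bar> + 1) * \<tau>\<^sup>2"
        using three_point_defect_bound[of 0 T "\<lambda>s. u s x" "\<lambda>s. D s x" B \<tau> "?t \<tau>" "?g \<tau>"]
          deriv[OF _ x] Lip[OF _ _ x] B \<tau> t by blast
      also have "\<dots> \<le> B * (c * \<tau> ^ (p - 1)) * (c + 1) * \<tau>\<^sup>2"
        using g B c \<tau> by (intro mult_right_mono mult_mono mult_left_mono) auto
      also have "\<dots> = (B * c * (c + 1)) * (\<tau> ^ (p - 1) * \<tau>\<^sup>2)"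
        by (simp only: mult_ac)
      also have "\<tau> ^ (p - 1) * \<tau>\<^sup>2 = \<tau> ^ (p + 1)"
        using params(6) by (simp flip: power_add)
      finally show "cmod (?defect \<tau> x) \<le> (B * c * (c + 1)) * \<tau> ^ (p + 1)" .
    qed
    show "B * c * (c + 1) \<ge> 0" using B c by simp
  qed
  moreover have "(\<lambda>\<tau>. cmod (complex_of_real (?g \<tau>))) \<in> O[at_right 0](\<lambda>_. 1)"
  proof (rule bigoI[where c = "c + 1"])
    show "\<forall>\<^sub>F \<tau> in at_right 0. norm (cmod (complex_of_real (?g \<tau>))) \<le> (c + 1) * norm (1::real)"
      using near_one by eventually_elim auto
  qed
  ultimately show ?thesis
    unfolding truncation_error_split by (rule L2_bigo_lincomb[OF _ order_p])
qed

end
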